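(* Let $p\ge 1$ be an integer and, for the simple symmetric random walk $(X_n)$ started from $0$ under $\mathbb{P}_0$, define $$\sigma_p=\inf\{k: X_k=p\},\quad \eta=\sup\{k\le\sigma_p: X_k=0\},\quad m=\sup\{X_k: k\le\eta\},\quad \gamma=\inf\{k\ge0: X_k=m\}.$$ If $(M_n)_{n\in\mathbb{N}}$ is a bounded martingale (under $\mathbb{P}_0$, with respect to the natural filtration of $(X_n)$), then $$\mathbb{E}_0[M_\gamma]=\mathbb{E}_0[M_0].$$ Thus $\gamma$ is a pseudo-stopping time.
   Context: $\Omega=\mathbb{Z}^{\mathbb{N}}$ with the product $\sigma$-field, $(X_n)$ is the coordinate process, $\mathcal{F}_n=\sigma(X_0,\dots,X_n)$, and $\mathbb{P}_0$ is the law under which $(X_n)$ is the standard random walk with Bernoulli increments started from $0$ (i.i.d. steps equal to $\pm1$ with probability $1/2$ each); $\mathbb{E}_0$ is expectation under $\mathbb{P}_0$. In this discrete setting, a random time $\gamma$ is called a pseudo-stopping time if $\mathbb{E}_0[M_\gamma]=\mathbb{E}_0[M_0]$ for every bounded $(\mathcal{F}_n)$-martingale $M$. *)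

theory Defs
  imports "HOL-Probability.Probability"
begin

section \<open>Bounded martingales and pseudo-stopping times in discrete time\<close>

definition bounded_martingale ::
    "'a measure \<Rightarrow> (nat \<Rightarrow> 'a measure) \<Rightarrow> (nat \<Rightarrow> 'a \<Rightarrow> real) \<Rightarrow> bool" where
  "bounded_martingale P F M \<longleftrightarrow>
     (\<forall>n. M n \<in> borel_measurable (F n)) \<and>
     (\<forall>n. integrable P (M n)) \<and>
     (\<forall>m n. m \<le> n \<longrightarrow> (AE \<omega> in P. real_cond_exp P (F m) (M n) \<omega> = M m \<omega>)) \<and>
     (\<exists>C. \<forall>n. AE \<omega> in P. \<bar>M n \<omega>\<bar> \<le> C)"

text \<open>
  Random times take values in the extended naturals. On the event that the time is infinite, a
  process is evaluated as its limit, which exists almost surely for bounded martingales.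
\<close>

definition value_at :: "(nat \<Rightarrow> 'a \<Rightarrow> real) \<Rightarrow> ('a \<Rightarrow> enat) \<Rightarrow> 'a \<Rightarrow> real" where
  "value_at M T \<omega> = (case T \<omega> of enat n \<Rightarrow> M n \<omega> | \<infinity> \<Rightarrow> lim (\<lambda>n. M n \<omega>))"

definition random_time :: "'a measure \<Rightarrow> ('a \<Rightarrow> enat) \<Rightarrow> bool" where
  "random_time P T \<longleftrightarrow> T \<in> P \<rightarrow>\<^sub>M count_space UNIV"

definition pseudo_stopping_time ::
    "'a measure \<Rightarrow> (nat \<Rightarrow> 'a measure) \<Rightarrow> ('a \<Rightarrow> enat) \<Rightarrow> bool" where
  "pseudo_stopping_time P F T \<longleftrightarrow> random_time P T \<and>
     (\<forall>M. bounded_martingale P F M \<longrightarrow>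
        integral\<^sup>L P (value_at M T) = integral\<^sup>L P (M 0))"


section \<open>The simple symmetric random walk on its canonical space\<close>

definition path_space :: "(nat \<Rightarrow> int) measure" where
  "path_space = (\<Pi>\<^sub>M n\<in>UNIV. count_space UNIV)"

definition X :: "nat \<Rightarrow> (nat \<Rightarrow> int) \<Rightarrow> int" where
  "X n \<omega> = \<omega> n"

definition natural_filtration :: "nat \<Rightarrow> (nat \<Rightarrow> int) measure" where
  "natural_filtration n = sigma UNIV {X k -` A | k A. k \<le> n}"

definition steps :: "(nat \<Rightarrow> int) measure" where
  "steps = (\<Pi>\<^sub>M n\<in>UNIV. measure_pmf (pmf_of_set {-1, 1}))"

definition P0 :: "(nat \<Rightarrow> int) measure" where
  "P0 = distr steps path_space (\<lambda>\<xi> n. \<Sum>i<n. \<xi> i)"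

lemma partial_sums_measurable: "(\<lambda>\<xi> n. \<Sum>i<n. \<xi> i) \<in> steps \<rightarrow>\<^sub>M path_space"
proof -
  have 1: "(\<lambda>\<xi>. \<xi> i) \<in> steps \<rightarrow>\<^sub>M count_space UNIV" for i
  proof -
    have "(\<lambda>\<xi>. \<xi> i) \<in> steps \<rightarrow>\<^sub>M measure_pmf (pmf_of_set {-1, 1 :: int})"
      unfolding steps_def by (rule measurable_component_singleton) simp
    then show ?thesis by simp
  qed
  have "(\<lambda>\<xi>. \<Sum>i<n. \<xi> i) \<in> steps \<rightarrow>\<^sub>M count_space UNIV" for n
  proof (induction n)
    case 0
    show ?case by simp
  next
    case (Suc n)
    have "(\<lambda>\<xi>. s + \<xi> n) \<in> steps \<rightarrow>\<^sub>M count_space UNIV" for s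
      by (rule measurable_compose[OF 1]) simp
    from measurable_compose_countable[OF this Suc] show ?case
      by simp
  qed
  then show ?thesis
    unfolding path_space_def by (intro measurable_PiM_single') auto
qed

lemma prob_space_P0: "prob_space P0"
proof -
  interpret prob_space steps
    unfolding steps_def by (intro prob_space_PiM prob_space_measure_pmf)
  show ?thesis
    unfolding P0_def by (rule prob_space_distr[OF partial_sums_measurable])
qed

lemma subalgebra_natural_filtration: "subalgebra P0 (natural_filtration n)"
proof -
  have "X k -` A \<in> sets path_space" for k A
  proof -
    have "X k \<in> path_space \<rightarrow>\<^sub>M count_space UNIV"
      unfolding path_space_def X_def by (rule measurable_component_singleton) simp
    from measurable_sets[OF this, of A] show ?thesis
      by (simp add: path_space_def space_PiM)
  qed
  then have *: "{X k -` A | k A. k \<le> n} \<subseteq> sets path_space"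
    by auto
  have "space path_space = UNIV"
    by (simp add: path_space_def space_PiM)
  with sets.sigma_sets_subset[OF *] show ?thesis
    by (simp add: subalgebra_def natural_filtration_def P0_def
        space_measure_of_conv sets_measure_of_conv)
qed


section \<open>The random times\<close>

definition sigma_hit :: "int \<Rightarrow> (nat \<Rightarrow> int) \<Rightarrow> enat" where
  "sigma_hit p \<omega> = Inf {enat k | k. X k \<omega> = p}"

definition eta :: "int \<Rightarrow> (nat \<Rightarrow> int) \<Rightarrow> enat" where
  "eta p \<omega> = Sup {enat k | k. enat k \<le> sigma_hit p \<omega> \<and> X k \<omega> = 0}"

text \<open>
  The supremum below is that of the conditionally complete order on the integers. For
  \<open>p \<ge> 1\<close> it is almost surely a genuine supremum: the set contains \<open>X 0\<close>, and
  for paths from \<open>0\<close> with steps \<open>\<plusminus>1\<close> it is bounded above by \<open>p\<close>,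
  even when \<open>p\<close> is never hit.
\<close>

definition max_before_eta :: "int \<Rightarrow> (nat \<Rightarrow> int) \<Rightarrow> int" where
  "max_before_eta p \<omega> = Sup {X k \<omega> | k. enat k \<le> eta p \<omega>}"

definition gamma :: "int \<Rightarrow> (nat \<Rightarrow> int) \<Rightarrow> enat" where
  "gamma p \<omega> = Inf {enat k | k. X k \<omega> = max_before_eta p \<omega>}"

end

theory Submission
  imports Defs
begin

text \<open>
  Let \<open>T j\<close> be the first time at which the walk visits the level \<open>j\<close>. Almost surely \<open>\<gamma> = T m\<close>, where
  the maximum \<open>m\<close> of the path before its last zero \<open>\<eta>\<close> prior to \<open>\<sigma>\<^sub>p\<close> lies between \<open>0\<close> and \<open>p - 1\<close>
  (\<open>gamma_path_decomposition\<close>). Although \<open>m\<close> looks into the future of \<open>T j\<close>, it does so in a very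
  simple way: \<open>m \<ge> j\<close> holds if and only if the walk, after \<open>T j\<close>, returns to \<open>0\<close> before it visits \<open>p\<close>.
  By the strong Markov property and the gambler's ruin formula, this event has conditional
  probability \<open>1 - j / p\<close> given the past of \<open>T j\<close>. Applying the same at \<open>T (j + 1)\<close>, whose past
  includes that of \<open>T j\<close>, shows that
  the event \<open>m = j\<close> has conditional probability \<open>(1 - j / p) - (1 - (j + 1) / p) = 1 / p\<close>.
  So \<open>m\<close> takes each of the \<open>p\<close> values with probability \<open>1 / p\<close>, and the event \<open>m = j\<close> is independent of the
  path up to \<open>T j\<close>. Hence the expectation of \<open>M\<close> at \<open>\<gamma>\<close> is the average over \<open>j < p\<close> of the
  expectations of \<open>M\<close> at \<open>T j\<close>, and each of these is the expectation of \<open>M 0\<close> by optional stopping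
  (\<open>integral_at_hit\<close>, \<open>integral_at_hit_returns\<close>, \<open>integral_at_gamma\<close>).

  All the probabilistic input comes from one identity, \<open>integral_known_increment\<close>: an increment of
  the walk has mean zero against every bounded function of the path before it. It gives optional
  stopping for the walk frozen on leaving an interval, that the walk leaves every bounded interval
  (\<open>AE_leaves_interval\<close>), the ruin formula (\<open>gamblers_ruin\<close>), and that every nonnegative level is
  visited (\<open>AE_hits_nonneg_level\<close>). Conditioning at the random time \<open>T j\<close> amounts to summing over its
  possible values (\<open>return_probability_at_hit\<close>).
\<close>

interpretation P0: prob_space P0
  by (rule prob_space_P0)

lemma sets_P0 [measurable_cong]: "sets P0 = sets path_space"
  by (simp add: P0_def)

lemma space_path_space [simp]: "space path_space = UNIV"
  by (simp add: path_space_def space_PiM)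

lemma space_P0 [simp]: "space P0 = UNIV"
  by (simp add: P0_def)

lemma measurable_X [measurable]: "X n \<in> path_space \<rightarrow>\<^sub>M count_space UNIV"
  unfolding path_space_def X_def by (rule measurable_component_singleton) simp

lemma measurable_real_X [measurable]: "(\<lambda>\<omega>. real_of_int (X n \<omega>)) \<in> borel_measurable path_space"
  by (rule measurable_compose[OF measurable_X]) simp

definition walk_path :: "(nat \<Rightarrow> int) \<Rightarrow> bool" where
  "walk_path \<omega> \<longleftrightarrow> X 0 \<omega> = 0 \<and> (\<forall>n. \<bar>X (Suc n) \<omega> - X n \<omega>\<bar> = 1)"

section \<open>Functions of the past of the walk\<close>

text \<open>
  A pointwise rendering of ``bounded and measurable at time \<open>n\<close>''. That a quantity depends only on
  the first coordinates is easy to verify path by path, even for one that involves a hitting time;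
  the link with the natural filtration is made by \<open>natural_filtration_cong\<close> and
  \<open>known_at_natural_filtration\<close>.
\<close>

definition known_at :: "nat \<Rightarrow> ((nat \<Rightarrow> int) \<Rightarrow> real) \<Rightarrow> bool" where
  "known_at n Z \<longleftrightarrow> Z \<in> borel_measurable path_space \<and> (\<exists>B. \<forall>\<omega>. \<bar>Z \<omega>\<bar> \<le> B) \<and>
     (\<forall>\<omega> \<omega>'. (\<forall>k\<le>n. X k \<omega> = X k \<omega>') \<longrightarrow> Z \<omega> = Z \<omega>')"

section \<open>Symmetry of the steps\<close>

lemma measurable_step: "(\<lambda>\<xi>. \<xi> n) \<in> steps \<rightarrow>\<^sub>M count_space UNIV"
proof -
  have "(\<lambda>\<xi>. \<xi> n) \<in> steps \<rightarrow>\<^sub>M measure_pmf (pmf_of_set {-1, 1 :: int})"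
    unfolding steps_def by (rule measurable_component_singleton) simp
  then show ?thesis by simp
qed

lemma AE_walk_path: "AE \<omega> in P0. walk_path \<omega>"
proof -
  have "AE \<xi> in steps. \<bar>\<xi> n\<bar> = 1" for n
    unfolding steps_def
    by (rule AE_PiM_component) (auto intro: prob_space_measure_pmf simp: AE_measure_pmf_iff)
  then have "AE \<xi> in steps. \<forall>n. \<bar>\<xi> n\<bar> = 1"
    by (simp add: AE_all_countable)
  then have "AE \<xi> in steps. walk_path (\<lambda>n. \<Sum>i<n. \<xi> i)"
    by eventually_elim (simp add: walk_path_def X_def)
  moreover have "Measurable.pred path_space walk_path"
    unfolding walk_path_def by measurable
  ultimately show ?thesis
    unfolding P0_def by (subst AE_distr_iff[OF partial_sums_measurable]) (auto simp: pred_def)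
qed

lemma measurable_flip: "(\<lambda>\<xi>. \<xi>(n := - \<xi> n)) \<in> steps \<rightarrow>\<^sub>M steps"
proof -
  have "(\<lambda>\<xi>. - \<xi> i) \<in> steps \<rightarrow>\<^sub>M count_space UNIV" for i
    by (rule measurable_compose[OF measurable_step]) simp
  then have "(\<lambda>\<xi>. (\<xi>(n := - \<xi> n)) i) \<in> steps \<rightarrow>\<^sub>M count_space UNIV" for i
    by (cases "i = n") (auto simp: measurable_step)
  then show ?thesis
    by (subst (2) steps_def, intro measurable_PiM_single') auto
qed

text \<open>
  The law of a single step is symmetric, so changing the sign of one coordinate preserves the
  product measure. All the independence that is needed below is extracted from this invariance.
\<close>

lemma distr_steps_flip:
  "distr steps steps (\<lambda>\<xi>. \<xi>(n := - \<xi> n)) = steps"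
proof -
  let ?M = "\<lambda>_::nat. measure_pmf (pmf_of_set {-1, 1 :: int})"
  interpret product_prob_space ?M UNIV
    by standard
  have sym: "map_pmf uminus (pmf_of_set {-1, 1 :: int}) = pmf_of_set {-1, 1}"
    by (subst map_pmf_of_set_inj) (auto intro: arg_cong[of _ _ pmf_of_set])
  have em: "emeasure (?M 0) (uminus -` A) = emeasure (?M 0) A" for A
    by (subst (2) sym[symmetric]) (simp only: emeasure_map_pmf)
  have flip: "(\<lambda>\<xi>. \<xi>(n := - \<xi> n)) \<in> PiM UNIV ?M \<rightarrow>\<^sub>M PiM UNIV ?M"
    using measurable_flip unfolding steps_def .
  show ?thesis
    unfolding steps_def
  proof (rule PiM_eq)
    fix J :: "nat set" and F :: "nat \<Rightarrow> int set"
    assume J: "finite J"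
    define F' where "F' = F(n := uminus -` F n)"
    have "emeasure (distr (PiM UNIV ?M) (PiM UNIV ?M) (\<lambda>\<xi>. \<xi>(n := - \<xi> n)))
            (prod_emb UNIV ?M J (Pi\<^sub>E J F)) =
          emeasure (PiM UNIV ?M) ((\<lambda>\<xi>. \<xi>(n := - \<xi> n)) -` prod_emb UNIV ?M J (Pi\<^sub>E J F) \<inter> space (PiM UNIV ?M))"
      using J by (intro emeasure_distr[OF flip] sets_PiM_I) auto
    also have "(\<lambda>\<xi>. \<xi>(n := - \<xi> n)) -` prod_emb UNIV ?M J (Pi\<^sub>E J F) \<inter> space (PiM UNIV ?M)
        = prod_emb UNIV ?M J (Pi\<^sub>E J F')"
      by (auto simp: prod_emb_def space_PiM F'_def PiE_iff split: if_splits)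
    also have "emeasure (PiM UNIV ?M) \<dots> = (\<Prod>j\<in>J. emeasure (?M j) (F' j))"
      using J by (intro emeasure_PiM_emb) auto
    also have "\<dots> = (\<Prod>j\<in>J. emeasure (?M j) (F j))"
      by (intro prod.cong refl) (auto simp: F'_def em)
    finally show "emeasure (distr (PiM UNIV ?M) (PiM UNIV ?M) (\<lambda>\<xi>. \<xi>(n := - \<xi> n)))
            (prod_emb UNIV ?M J (Pi\<^sub>E J F)) = (\<Prod>j\<in>J. emeasure (?M j) (F j))" .
  qed simp
qed

text \<open>
  Reflecting the step from \<open>n\<close> to \<open>n + 1\<close> leaves \<open>Z\<close> unchanged and reverses the increment, so the
  expectation equals its own negative. This says that the walk is a martingale, and it is the only
  property of its law, besides the shape of the paths, that the rest of the proof relies on.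
\<close>

lemma integral_known_increment:
  assumes Z: "known_at n Z"
  shows "(\<integral>\<omega>. Z \<omega> * (real_of_int (X (Suc n) \<omega>) - real_of_int (X n \<omega>)) \<partial>P0) = 0"
proof -
  let ?S = "\<lambda>\<xi> n. \<Sum>i<n. \<xi> i :: int"
  have [measurable]: "Z \<in> borel_measurable path_space"
    using Z by (simp add: known_at_def)
  note [measurable] = partial_sums_measurable measurable_step measurable_flip
  have "(\<lambda>\<omega>. Z \<omega> * (real_of_int (X (Suc n) \<omega>) - real_of_int (X n \<omega>))) \<in> borel_measurable path_space"
    by measurable
  then have walk: "(\<integral>\<omega>. Z \<omega> * (real_of_int (X (Suc n) \<omega>) - real_of_int (X n \<omega>)) \<partial>P0) = (\<integral>\<xi>. Z (?S \<xi>) * \<xi> n \<partial>steps)"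
    unfolding P0_def by (subst integral_distr[OF partial_sums_measurable]) (auto simp: X_def)
  have meas: "(\<lambda>\<xi>. Z (?S \<xi>) * \<xi> n) \<in> borel_measurable steps"
    by measurable
  have "(\<integral>\<xi>. Z (?S \<xi>) * \<xi> n \<partial>steps) = (\<integral>\<xi>. Z (?S \<xi>) * \<xi> n \<partial>distr steps steps (\<lambda>\<xi>. \<xi>(n := - \<xi> n)))"
    by (simp only: distr_steps_flip)
  also have "\<dots> = (\<integral>\<xi>. Z (?S (\<xi>(n := - \<xi> n))) * - \<xi> n \<partial>steps)"
    by (subst integral_distr[OF measurable_flip meas]) simp
  also have "\<dots> = (\<integral>\<xi>. - (Z (?S \<xi>) * \<xi> n) \<partial>steps)"
  proof (intro Bochner_Integration.integral_cong refl)
    fix \<xi> :: "nat \<Rightarrow> int"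
    have "Z (?S (\<xi>(n := - \<xi> n))) = Z (?S \<xi>)"
      using Z unfolding known_at_def X_def
      by (elim conjE allE[of _ "?S (\<xi>(n := - \<xi> n))"] allE[of _ "?S \<xi>"] mp)
         (auto intro!: sum.cong)
    then show "Z (?S (\<xi>(n := - \<xi> n))) * - \<xi> n = - (Z (?S \<xi>) * \<xi> n)"
      by simp
  qed
  also have "\<dots> = - (\<integral>\<xi>. Z (?S \<xi>) * \<xi> n \<partial>steps)"
    by simp
  finally show ?thesis
    unfolding walk by simp
qed

lemma known_atI:
  assumes "Z \<in> borel_measurable path_space" "\<And>\<omega>. \<bar>Z \<omega>\<bar> \<le> B"
    "\<And>\<omega> \<omega>'. (\<And>k. k \<le> n \<Longrightarrow> X k \<omega> = X k \<omega>') \<Longrightarrow> Z \<omega> = Z \<omega>'"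
  shows "known_at n Z"
  unfolding known_at_def using assms by blast

lemma known_at_measurable: "known_at n Z \<Longrightarrow> Z \<in> borel_measurable path_space"
  by (simp add: known_at_def)

lemma known_at_bound:
  assumes "known_at n Z"
  shows "\<exists>B\<ge>0. \<forall>\<omega>. \<bar>Z \<omega>\<bar> \<le> B"
  using assms unfolding known_at_def by (meson abs_ge_zero order_trans)

lemma known_at_cong:
  "known_at n Z \<Longrightarrow> (\<And>k. k \<le> n \<Longrightarrow> X k \<omega> = X k \<omega>') \<Longrightarrow> Z \<omega> = Z \<omega>'"
  unfolding known_at_def by blast

lemma known_at_mult:
  assumes Y: "known_at m Y" and Z: "known_at n Z" and le: "m \<le> n"
  shows "known_at n (\<lambda>\<omega>. Y \<omega> * Z \<omega>)"
proof -
  note [measurable] = known_at_measurable[OF Y] known_at_measurable[OF Z]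
  obtain B where B: "B \<ge> 0" "\<And>\<omega>. \<bar>Y \<omega>\<bar> \<le> B"
    using known_at_bound[OF Y] by auto
  obtain C where C: "C \<ge> 0" "\<And>\<omega>. \<bar>Z \<omega>\<bar> \<le> C"
    using known_at_bound[OF Z] by auto
  from B C have bound: "\<bar>Y \<omega> * Z \<omega>\<bar> \<le> B * C" for \<omega>
    unfolding abs_mult by (intro mult_mono) auto
  have cong: "Y \<omega> * Z \<omega> = Y \<omega>' * Z \<omega>'" if "\<And>k. k \<le> n \<Longrightarrow> X k \<omega> = X k \<omega>'" for \<omega> \<omega>'
    using known_at_cong[OF Y, of \<omega> \<omega>'] known_at_cong[OF Z, of \<omega> \<omega>'] that le by simp
  show ?thesis
    by (rule known_atI[OF _ bound cong]) measurable
qed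

lemma integrable_P0:
  fixes f :: "(nat \<Rightarrow> int) \<Rightarrow> real"
  assumes "f \<in> borel_measurable path_space" "\<And>\<omega>. walk_path \<omega> \<Longrightarrow> \<bar>f \<omega>\<bar> \<le> B"
  shows "integrable P0 f"
proof (rule P0.integrable_const_bound[of _ B])
  show "AE \<omega> in P0. norm (f \<omega>) \<le> B"
    using AE_walk_path by eventually_elim (simp add: assms)
qed (use assms in measurable)

lemma tendsto_integral_P0:
  fixes f :: "nat \<Rightarrow> (nat \<Rightarrow> int) \<Rightarrow> real"
  assumes "\<And>i. f i \<in> borel_measurable path_space" "g \<in> borel_measurable path_space"
    and "\<And>i \<omega>. walk_path \<omega> \<Longrightarrow> \<bar>f i \<omega>\<bar> \<le> B"
    and "AE \<omega> in P0. (\<lambda>i. f i \<omega>) \<longlonglongrightarrow> g \<omega>"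
  shows "(\<lambda>i. \<integral>\<omega>. f i \<omega> \<partial>P0) \<longlonglongrightarrow> (\<integral>\<omega>. g \<omega> \<partial>P0)"
proof (rule integral_dominated_convergence)
  show "AE \<omega> in P0. norm (f i \<omega>) \<le> B" for i
    using AE_walk_path by eventually_elim (simp add: assms)
qed (use assms in \<open>auto simp: measurable_cong_sets[OF sets_P0 refl]\<close>)

section \<open>Exit from an interval and the gambler's ruin\<close>

lemma walk_path_step: "walk_path \<omega> \<Longrightarrow> X (Suc n) \<omega> - X n \<omega> = 1 \<or> X (Suc n) \<omega> - X n \<omega> = -1"
  unfolding walk_path_def by (metis abs_eq_iff abs_1)

lemma walk_path_bound: "walk_path \<omega> \<Longrightarrow> \<bar>X n \<omega>\<bar> \<le> int n"
proof (induction n)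
  case (Suc n)
  then show ?case using walk_path_step[of \<omega> n] by linarith
qed (simp add: walk_path_def)

text \<open>
  The walk observed from time \<open>n\<close> on and frozen at its first exit from the open interval between
  \<open>a\<close> and \<open>b\<close>, as a function of the time \<open>i\<close> elapsed since \<open>n\<close>. The recursion expresses it as a sum
  of increments switched on and off by the past, which is the form that suits
  \<open>integral_known_increment\<close>.
\<close>

primrec absorbed :: "int \<Rightarrow> int \<Rightarrow> nat \<Rightarrow> nat \<Rightarrow> (nat \<Rightarrow> int) \<Rightarrow> int" where
  "absorbed a b n 0 \<omega> = X n \<omega>"
| "absorbed a b n (Suc i) \<omega> = absorbed a b n i \<omega> +
     (if absorbed a b n i \<omega> \<in> {a<..<b} then X (Suc (n + i)) \<omega> - X (n + i) \<omega> else 0)"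

definition reaches_before :: "nat \<Rightarrow> int \<Rightarrow> int \<Rightarrow> (nat \<Rightarrow> int) \<Rightarrow> bool" where
  "reaches_before n a b \<omega> \<longleftrightarrow> (\<exists>k\<ge>n. X k \<omega> = a \<and> (\<forall>i\<in>{n..k}. X i \<omega> \<noteq> b))"

lemma measurable_absorbed [measurable]: "absorbed a b n i \<in> path_space \<rightarrow>\<^sub>M count_space UNIV"
  by (induction i) simp_all

lemma measurable_real_absorbed [measurable]:
  "(\<lambda>\<omega>. real_of_int (absorbed a b n i \<omega>)) \<in> borel_measurable path_space"
  by (rule measurable_compose[OF measurable_absorbed]) simp

lemma measurable_absorbed_mem [measurable]:
  "Measurable.pred path_space (\<lambda>\<omega>. absorbed a b n i \<omega> \<in> S)"
  by (rule measurable_compose[OF measurable_absorbed]) simp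

lemma measurable_reaches_before [measurable]: "Measurable.pred path_space (reaches_before n a b)"
  unfolding reaches_before_def by measurable

lemma absorbed_cong:
  "(\<And>k. k \<le> n + i \<Longrightarrow> X k \<omega> = X k \<omega>') \<Longrightarrow> absorbed a b n i \<omega> = absorbed a b n i \<omega>'"
  by (induction i) simp_all

lemma absorbed_bound:
  assumes "walk_path \<omega>"
  shows "\<bar>absorbed a b n i \<omega>\<bar> \<le> \<bar>a\<bar> + \<bar>b\<bar> + int n"
proof (induction i)
  case 0
  then show ?case using walk_path_bound[OF assms, of n] by simp
next
  case (Suc i)
  then show ?case using walk_path_step[OF assms, of "n + i"] by auto
qed

text \<open>
  The weights to which \<open>integral_known_increment\<close> gets applied. A function of the frozen walk is
  bounded as soon as it vanishes outside the interval, because only finitely many values remain.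
\<close>

lemma known_at_inside:
  fixes g :: "int \<Rightarrow> real"
  shows "known_at (n + i) (\<lambda>\<omega>. of_bool (absorbed a b n i \<omega> \<in> {a<..<b}) * g (absorbed a b n i \<omega>))"
proof (rule known_atI[where B = "\<Sum>y\<in>{a<..<b}. \<bar>g y\<bar>"])
  show "\<bar>of_bool (absorbed a b n i \<omega> \<in> {a<..<b}) * g (absorbed a b n i \<omega>)\<bar> \<le> (\<Sum>y\<in>{a<..<b}. \<bar>g y\<bar>)" for \<omega>
    using member_le_sum[of "absorbed a b n i \<omega>" "{a<..<b}" "\<lambda>y. \<bar>g y\<bar>"]
    by (auto simp: sum_nonneg)
  fix \<omega> \<omega>' :: "nat \<Rightarrow> int"
  assume "\<And>k. k \<le> n + i \<Longrightarrow> X k \<omega> = X k \<omega>'"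
  then have "absorbed a b n i \<omega> = absorbed a b n i \<omega>'"
    by (rule absorbed_cong)
  then show "of_bool (absorbed a b n i \<omega> \<in> {a<..<b}) * g (absorbed a b n i \<omega>)
    = of_bool (absorbed a b n i \<omega>' \<in> {a<..<b}) * g (absorbed a b n i \<omega>')" by simp
qed (rule measurable_compose[OF measurable_absorbed], simp)

text \<open>
  Optional stopping for the frozen walk: each of its increments is an increment of the walk times a
  weight known beforehand.
\<close>

lemma integral_known_absorbed:
  assumes Z: "known_at n Z"
  shows "(\<integral>\<omega>. Z \<omega> * absorbed a b n i \<omega> \<partial>P0) = (\<integral>\<omega>. Z \<omega> * X n \<omega> \<partial>P0)"
proof (induction i)
  case (Suc i)
  note [measurable] = known_at_measurable[OF Z]
  obtain B where B: "B \<ge> 0" "\<And>\<omega>. \<bar>Z \<omega>\<bar> \<le> B"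
    using known_at_bound[OF Z] by auto
  let ?I = "\<lambda>\<omega>. of_bool (absorbed a b n i \<omega> \<in> {a<..<b}) :: real"
  let ?D = "\<lambda>\<omega>. real_of_int (X (Suc (n + i)) \<omega>) - real_of_int (X (n + i) \<omega>)"
  have int1: "integrable P0 (\<lambda>\<omega>. Z \<omega> * absorbed a b n i \<omega>)"
  proof (rule integrable_P0)
    fix \<omega> assume "walk_path \<omega>"
    from absorbed_bound[OF this, of a b n i]
    have "\<bar>real_of_int (absorbed a b n i \<omega>)\<bar> \<le> real_of_int (\<bar>a\<bar> + \<bar>b\<bar> + int n)"
      by linarith
    then show "\<bar>Z \<omega> * absorbed a b n i \<omega>\<bar> \<le> B * real_of_int (\<bar>a\<bar> + \<bar>b\<bar> + int n)"
      unfolding abs_mult using B by (intro mult_mono) auto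
  qed measurable
  have int2: "integrable P0 (\<lambda>\<omega>. Z \<omega> * ?I \<omega> * ?D \<omega>)"
  proof (rule integrable_P0)
    fix \<omega> assume "walk_path \<omega>"
    then have "\<bar>?D \<omega>\<bar> = 1"
      using walk_path_step[of \<omega> "n + i"] by linarith
    then show "\<bar>Z \<omega> * ?I \<omega> * ?D \<omega>\<bar> \<le> B"
      using B by (simp add: abs_mult)
  qed measurable
  have K: "known_at (n + i) (\<lambda>\<omega>. Z \<omega> * ?I \<omega>)"
    using known_at_mult[OF Z known_at_inside[of n i a b "\<lambda>_. 1"]] by simp
  have "(\<integral>\<omega>. Z \<omega> * absorbed a b n (Suc i) \<omega> \<partial>P0)
      = (\<integral>\<omega>. Z \<omega> * absorbed a b n i \<omega> + Z \<omega> * ?I \<omega> * ?D \<omega> \<partial>P0)"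
    by (intro Bochner_Integration.integral_cong) (auto simp: algebra_simps)
  also have "\<dots> = (\<integral>\<omega>. Z \<omega> * absorbed a b n i \<omega> \<partial>P0) + (\<integral>\<omega>. Z \<omega> * ?I \<omega> * ?D \<omega> \<partial>P0)"
    by (rule Bochner_Integration.integral_add[OF int1 int2])
  also have "(\<integral>\<omega>. Z \<omega> * ?I \<omega> * ?D \<omega> \<partial>P0) = 0"
    by (rule integral_known_increment[OF K])
  finally show ?case using Suc by simp
qed simp

text \<open>
  As long as the walk stays inside the interval, the second moment of the frozen walk grows at each
  step by exactly the probability of still being inside, since the squared increments are \<open>1\<close>. This
  second moment is bounded, so the probability \<open>q\<close> of never leaving satisfies \<open>N * q \<le> B\<^sup>2\<close> for every
  \<open>N\<close>, which forces \<open>q = 0\<close>.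
\<close>

lemma AE_leaves_interval: "AE \<omega> in P0. \<exists>i. absorbed a b n i \<omega> \<notin> {a<..<b}"
proof -
  define Y where "Y i \<omega> = real_of_int (absorbed a b n i \<omega>)" for i \<omega>
  define I where "I i \<omega> = (of_bool (absorbed a b n i \<omega> \<in> {a<..<b}) :: real)" for i \<omega>
  define D where "D i \<omega> = real_of_int (X (Suc (n + i)) \<omega>) - real_of_int (X (n + i) \<omega>)" for i \<omega>
  define B where "B = real_of_int (\<bar>a\<bar> + \<bar>b\<bar> + int n)"
  let ?all = "\<lambda>\<omega>. of_bool (\<forall>i. absorbed a b n i \<omega> \<in> {a<..<b}) :: real"
  have meas [measurable]: "Y i \<in> borel_measurable path_space" "I i \<in> borel_measurable path_space"
    "D i \<in> borel_measurable path_space" for i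
    unfolding Y_def I_def D_def by (rule measurable_real_absorbed, measurable)
  have Y_le: "\<bar>Y i \<omega>\<bar> \<le> B" if "walk_path \<omega>" for i \<omega>
    using absorbed_bound[OF that, of a b n i] unfolding Y_def B_def by linarith
  have Y2_le: "(Y i \<omega>)\<^sup>2 \<le> B\<^sup>2" if "walk_path \<omega>" for i \<omega>
    using power_mono[OF Y_le[OF that, of i], of 2] by simp
  have D_abs: "\<bar>D i \<omega>\<bar> = 1" if "walk_path \<omega>" for i \<omega>
    using walk_path_step[OF that, of "n + i"] unfolding D_def by linarith
  have D2: "(D i \<omega>)\<^sup>2 = 1" if "walk_path \<omega>" for i \<omega>
    using D_abs[OF that, of i] by (metis power2_abs one_power2)
  have int_Y2: "integrable P0 (\<lambda>\<omega>. (Y i \<omega>)\<^sup>2)" for i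
    by (rule integrable_P0[of _ "B\<^sup>2"]) (use Y2_le in auto)
  have int_I: "integrable P0 (I i)" for i
    by (rule integrable_P0[of _ 1]) (auto simp: I_def)
  have int_YD: "integrable P0 (\<lambda>\<omega>. (I i \<omega> * (2 * Y i \<omega>)) * D i \<omega>)" for i
  proof (rule integrable_P0[of _ "2 * B"])
    fix \<omega> assume "walk_path \<omega>"
    then show "\<bar>(I i \<omega> * (2 * Y i \<omega>)) * D i \<omega>\<bar> \<le> 2 * B"
      using D_abs[of \<omega> i] Y_le[of \<omega> i] by (auto simp: I_def abs_mult)
  qed simp
  have step: "(\<integral>\<omega>. (Y (Suc i) \<omega>)\<^sup>2 \<partial>P0) = (\<integral>\<omega>. (Y i \<omega>)\<^sup>2 \<partial>P0) + (\<integral>\<omega>. I i \<omega> \<partial>P0)" for i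
  proof -
    have "(\<integral>\<omega>. (Y (Suc i) \<omega>)\<^sup>2 \<partial>P0) =
        (\<integral>\<omega>. (Y i \<omega>)\<^sup>2 + ((I i \<omega> * (2 * Y i \<omega>)) * D i \<omega> + I i \<omega>) \<partial>P0)"
    proof (rule integral_cong_AE)
      show "AE \<omega> in P0. (Y (Suc i) \<omega>)\<^sup>2 = (Y i \<omega>)\<^sup>2 + ((I i \<omega> * (2 * Y i \<omega>)) * D i \<omega> + I i \<omega>)"
        using AE_walk_path
      proof eventually_elim
        case (elim \<omega>)
        have "Y (Suc i) \<omega> = Y i \<omega> + I i \<omega> * D i \<omega>"
          by (simp add: Y_def I_def D_def)
        moreover have "I i \<omega> = 0 \<or> I i \<omega> = 1"
          by (simp add: I_def)
        ultimately show ?case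
          using D2[OF elim, of i] by (auto simp: power2_sum)
      qed
    qed auto
    also have "\<dots> = (\<integral>\<omega>. (Y i \<omega>)\<^sup>2 \<partial>P0) +
        ((\<integral>\<omega>. (I i \<omega> * (2 * Y i \<omega>)) * D i \<omega> \<partial>P0) + (\<integral>\<omega>. I i \<omega> \<partial>P0))"
      by (simp add: int_Y2 int_YD int_I del: mult.assoc)
    also have "(\<integral>\<omega>. (I i \<omega> * (2 * Y i \<omega>)) * D i \<omega> \<partial>P0) = 0"
      unfolding I_def Y_def D_def
      by (rule integral_known_increment[OF known_at_inside[of n i a b "\<lambda>y. 2 * real_of_int y"]])
    finally show ?thesis by simp
  qed
  have le: "real N * (\<integral>\<omega>. ?all \<omega> \<partial>P0) \<le> B\<^sup>2" for N
  proof -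
    have "(\<integral>\<omega>. (Y 0 \<omega>)\<^sup>2 \<partial>P0) + real N * (\<integral>\<omega>. ?all \<omega> \<partial>P0) \<le> (\<integral>\<omega>. (Y N \<omega>)\<^sup>2 \<partial>P0)"
    proof (induction N)
      case (Suc N)
      have "(\<integral>\<omega>. ?all \<omega> \<partial>P0) \<le> (\<integral>\<omega>. I N \<omega> \<partial>P0)"
        by (intro integral_mono int_I integrable_P0[of _ 1]) (auto simp: I_def)
      with Suc show ?case by (simp add: step algebra_simps)
    qed simp
    moreover have "(\<integral>\<omega>. (Y N \<omega>)\<^sup>2 \<partial>P0) \<le> B\<^sup>2"
      by (rule P0.integral_le_const[OF int_Y2]) (use AE_walk_path Y2_le in auto)
    moreover have "(\<integral>\<omega>. (Y 0 \<omega>)\<^sup>2 \<partial>P0) \<ge> 0"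
      by simp
    ultimately show ?thesis by linarith
  qed
  have "(\<integral>\<omega>. ?all \<omega> \<partial>P0) \<le> 0"
  proof (rule ccontr)
    assume "\<not> ?thesis"
    then obtain N where "B\<^sup>2 < real N * (\<integral>\<omega>. ?all \<omega> \<partial>P0)"
      using reals_Archimedean3[of "\<integral>\<omega>. ?all \<omega> \<partial>P0"] by auto
    with le[of N] show False by simp
  qed
  then have "(\<integral>\<omega>. ?all \<omega> \<partial>P0) = 0"
    by (intro antisym) simp_all
  then have "AE \<omega> in P0. ?all \<omega> = 0"
    by (subst (asm) integral_nonneg_eq_0_iff_AE) (auto intro!: integrable_P0[of _ 1])
  then show ?thesis
    by eventually_elim simp
qed

text \<open>
  Links the frozen walk to the event \<open>reaches_before\<close>: at every time it is either still inside, or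
  has been frozen at the end point that this event dictates. The clause \<open>\<exists>k. X k \<omega> = b\<close> serves to show
  that a path which never visits \<open>b\<close> must be frozen at \<open>a\<close>.
\<close>

lemma absorbed_invariant:
  assumes \<omega>: "walk_path \<omega>" and ab: "a < b" and X: "X n \<omega> \<in> {a..b}"
  shows "absorbed a b n i \<omega> \<in> {a<..<b} \<and> absorbed a b n i \<omega> = X (n + i) \<omega> \<and>
           (\<forall>k\<in>{n..n+i}. X k \<omega> \<in> {a<..<b}) \<or>
         absorbed a b n i \<omega> = a \<and> reaches_before n a b \<omega> \<or>
         absorbed a b n i \<omega> = b \<and> \<not> reaches_before n a b \<omega> \<and> (\<exists>k. X k \<omega> = b)"
proof (induction i)
  case 0
  consider "X n \<omega> = a" | "X n \<omega> = b" | "X n \<omega> \<in> {a<..<b}"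
    using X by force
  then show ?case
  proof cases
    case 1
    then show ?thesis using ab by (auto simp: reaches_before_def intro!: exI[of _ n])
  next
    case 2
    then show ?thesis using ab by (auto simp: reaches_before_def)
  qed auto
next
  case (Suc i)
  show ?case
  proof (cases "absorbed a b n i \<omega> \<in> {a<..<b}")
    case True
    with Suc ab have eq: "absorbed a b n (Suc i) \<omega> = X (Suc (n + i)) \<omega>"
      and near: "X (n + i) \<omega> \<in> {a<..<b}" and in_ab: "\<forall>k\<in>{n..n+i}. X k \<omega> \<in> {a<..<b}"
      by auto
    consider "X (Suc (n + i)) \<omega> = a" | "X (Suc (n + i)) \<omega> = b" | "X (Suc (n + i)) \<omega> \<in> {a<..<b}"
      using near walk_path_step[OF \<omega>, of "n + i"] by force
    then show ?thesis
    proof cases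
      case 1
      then have "reaches_before n a b \<omega>"
        using in_ab ab unfolding reaches_before_def
        by (intro exI[of _ "Suc (n + i)"]) (force simp: le_Suc_eq)
      then show ?thesis using eq 1 by simp
    next
      case 2
      have "\<not> reaches_before n a b \<omega>"
      proof
        assume "reaches_before n a b \<omega>"
        then obtain k where "k \<ge> n" "X k \<omega> = a" "\<forall>j\<in>{n..k}. X j \<omega> \<noteq> b"
          unfolding reaches_before_def by blast
        moreover from this have "\<not> k \<le> n + i"
          using in_ab by force
        ultimately show False using 2 by auto
      qed
      then show ?thesis using eq 2 by auto
    next
      case 3
      then show ?thesis using eq in_ab by (auto simp: le_Suc_eq)
    qed
  next
    case False
    with Suc ab show ?thesis by auto
  qed
qed

text \<open>
  The gambler's ruin formula conditionally on the past up to time \<open>n\<close>, with \<open>Z\<close> in the role of the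
  conditioning. It compares the initial position of the frozen walk with its limit, which is \<open>a\<close> on
  the event \<open>reaches_before n a b\<close> and \<open>b\<close> off it.
\<close>

lemma gamblers_ruin:
  fixes Z :: "(nat \<Rightarrow> int) \<Rightarrow> real"
  assumes Z: "known_at n Z" and ab: "a < b"
    and supp: "\<And>\<omega>. Z \<omega> \<noteq> 0 \<Longrightarrow> X n \<omega> \<in> {a..b}"
  shows "real_of_int (b - a) * (\<integral>\<omega>. Z \<omega> * of_bool (reaches_before n a b \<omega>) \<partial>P0)
       = (\<integral>\<omega>. Z \<omega> * real_of_int (b - X n \<omega>) \<partial>P0)"
proof -
  note [measurable] = known_at_measurable[OF Z]
  obtain B where B: "B \<ge> 0" "\<And>\<omega>. \<bar>Z \<omega>\<bar> \<le> B"
    using known_at_bound[OF Z] by auto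
  let ?C = "real_of_int (\<bar>a\<bar> + \<bar>b\<bar> + int n)"
  let ?L = "\<lambda>\<omega>. real_of_int (if reaches_before n a b \<omega> then a else b)"
  have absorbed_le: "\<bar>Z \<omega> * absorbed a b n i \<omega>\<bar> \<le> B * ?C" if "walk_path \<omega>" for \<omega> i
  proof -
    have "\<bar>real_of_int (absorbed a b n i \<omega>)\<bar> \<le> ?C"
      using absorbed_bound[OF that, of a b n i] by linarith
    then show ?thesis
      unfolding abs_mult using B by (intro mult_mono) auto
  qed
  have "(\<lambda>i. \<integral>\<omega>. Z \<omega> * absorbed a b n i \<omega> \<partial>P0) \<longlonglongrightarrow> (\<integral>\<omega>. Z \<omega> * ?L \<omega> \<partial>P0)"
  proof (rule tendsto_integral_P0[OF _ _ absorbed_le])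
    show "AE \<omega> in P0. (\<lambda>i. Z \<omega> * absorbed a b n i \<omega>) \<longlonglongrightarrow> Z \<omega> * ?L \<omega>"
      using AE_walk_path AE_leaves_interval[of a b n]
    proof eventually_elim
      case (elim \<omega>)
      then obtain i0 where i0: "absorbed a b n i0 \<omega> \<notin> {a<..<b}" by blast
      have stay: "absorbed a b n i \<omega> \<notin> {a<..<b}" if "i \<ge> i0" for i
        using that i0 by (induction i rule: dec_induct) auto
      show ?case
      proof (cases "Z \<omega> = 0")
        case False
        then have "Z \<omega> * absorbed a b n i \<omega> = Z \<omega> * ?L \<omega>" if "i \<ge> i0" for i
          using absorbed_invariant[OF elim(1) ab supp[OF False], of i] stay[OF that] by auto
        then show ?thesis
          by (intro tendsto_eventually eventually_sequentiallyI[of i0])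
      qed simp
    qed
  qed measurable
  then have lim: "(\<integral>\<omega>. Z \<omega> * X n \<omega> \<partial>P0) = (\<integral>\<omega>. Z \<omega> * ?L \<omega> \<partial>P0)"
    unfolding integral_known_absorbed[OF Z] by (simp add: LIMSEQ_const_iff)
  have int_Z: "integrable P0 (\<lambda>\<omega>. Z \<omega> * b)"
    using B by (intro integrable_P0[of _ "B * \<bar>real_of_int b\<bar>"]) (auto simp: abs_mult mult_right_mono)
  have int_ZX: "integrable P0 (\<lambda>\<omega>. Z \<omega> * X n \<omega>)"
    using absorbed_le[of _ 0] by (intro integrable_P0[of _ "B * ?C"]) auto
  have int_ZR: "integrable P0 (\<lambda>\<omega>. (b - a) * (Z \<omega> * of_bool (reaches_before n a b \<omega>)))"
    using B ab by (intro integrable_P0[of _ "(b - a) * B"]) (auto simp: abs_mult)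
  have "(\<integral>\<omega>. Z \<omega> * real_of_int (b - X n \<omega>) \<partial>P0) = (\<integral>\<omega>. Z \<omega> * b \<partial>P0) - (\<integral>\<omega>. Z \<omega> * X n \<omega> \<partial>P0)"
    unfolding of_int_diff right_diff_distrib by (rule Bochner_Integration.integral_diff[OF int_Z int_ZX])
  also have "(\<integral>\<omega>. Z \<omega> * X n \<omega> \<partial>P0)
      = (\<integral>\<omega>. Z \<omega> * b - (b - a) * (Z \<omega> * of_bool (reaches_before n a b \<omega>)) \<partial>P0)"
    unfolding lim by (intro Bochner_Integration.integral_cong) (auto simp: algebra_simps)
  also have "\<dots> = (\<integral>\<omega>. Z \<omega> * b \<partial>P0)
      - (\<integral>\<omega>. (b - a) * (Z \<omega> * of_bool (reaches_before n a b \<omega>)) \<partial>P0)"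
    by (rule Bochner_Integration.integral_diff[OF int_Z int_ZR])
  finally show ?thesis by simp
qed

text \<open>
  A path that never visits \<open>b\<close> reaches \<open>-K\<close> before \<open>b\<close> for every \<open>K\<close>, because it almost surely leaves
  the interval between \<open>-K\<close> and \<open>b\<close>. By the ruin formula this has probability \<open>b / (b + K)\<close>, which
  tends to \<open>0\<close>.
\<close>

lemma AE_hits_nonneg_level:
  assumes "b \<ge> 0"
  shows "AE \<omega> in P0. \<exists>k. X k \<omega> = b"
proof (cases "b = 0")
  case True
  show ?thesis
    using AE_walk_path by eventually_elim (auto simp: walk_path_def True)
next
  case False
  with assms have b: "b \<ge> 1" by simp
  let ?never = "\<lambda>\<omega>. of_bool (\<forall>k. X k \<omega> \<noteq> b) :: real"
  have le: "real K * (\<integral>\<omega>. ?never \<omega> \<partial>P0) \<le> b" for K :: nat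
  proof -
    let ?a = "- int K"
    \<comment> \<open>The constant weight \<open>1\<close> almost surely; the indicator confines the start of every path to the interval.\<close>
    let ?Z = "\<lambda>\<omega>. of_bool (X 0 \<omega> = 0) :: real"
    let ?R = "\<lambda>\<omega>. ?Z \<omega> * of_bool (reaches_before 0 ?a b \<omega>)"
    have int: "integrable P0 ?never" "integrable P0 ?R"
      by (rule integrable_P0[of _ 1]; simp)+
    have "(\<integral>\<omega>. ?never \<omega> \<partial>P0) \<le> (\<integral>\<omega>. ?R \<omega> \<partial>P0)"
    proof (rule integral_mono_AE[OF int])
      show "AE \<omega> in P0. ?never \<omega> \<le> ?R \<omega>"
        using AE_walk_path AE_leaves_interval[of ?a b 0]
      proof eventually_elim
        case (elim \<omega>)
        then obtain i where "absorbed ?a b 0 i \<omega> \<notin> {?a<..<b}" by blast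
        moreover have "X 0 \<omega> = 0" using elim by (simp add: walk_path_def)
        ultimately show ?case
          using absorbed_invariant[OF elim(1), of ?a b 0 i] b by auto
      qed
    qed
    moreover have "(b - ?a) * (\<integral>\<omega>. ?R \<omega> \<partial>P0) = b"
    proof -
      have "known_at 0 ?Z"
        by (rule known_atI[of _ 1]) auto
      then have "real_of_int (b - ?a) * (\<integral>\<omega>. ?R \<omega> \<partial>P0) = (\<integral>\<omega>. ?Z \<omega> * real_of_int (b - X 0 \<omega>) \<partial>P0)"
        using b by (intro gamblers_ruin) auto
      also have "\<dots> = (\<integral>\<omega>. b \<partial>P0)"
      proof (rule integral_cong_AE)
        show "AE \<omega> in P0. ?Z \<omega> * real_of_int (b - X 0 \<omega>) = b"
          using AE_walk_path by eventually_elim (simp add: walk_path_def)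
      qed simp_all
      finally show ?thesis using P0.prob_space by simp
    qed
    moreover have "real K * (\<integral>\<omega>. ?R \<omega> \<partial>P0) \<le> (b - ?a) * (\<integral>\<omega>. ?R \<omega> \<partial>P0)"
      using b by (intro mult_right_mono) auto
    ultimately show ?thesis
      using mult_left_mono[of "\<integral>\<omega>. ?never \<omega> \<partial>P0" "\<integral>\<omega>. ?R \<omega> \<partial>P0" "real K"] by linarith
  qed
  have "(\<integral>\<omega>. ?never \<omega> \<partial>P0) \<le> 0"
  proof (rule ccontr)
    assume "\<not> ?thesis"
    then obtain N where "real_of_int b < real N * (\<integral>\<omega>. ?never \<omega> \<partial>P0)"
      using reals_Archimedean3[of "\<integral>\<omega>. ?never \<omega> \<partial>P0"] by auto
    with le[of N] show False by simp
  qed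
  then have "(\<integral>\<omega>. ?never \<omega> \<partial>P0) = 0"
    by (intro antisym) simp_all
  then have "AE \<omega> in P0. ?never \<omega> = 0"
    by (subst (asm) integral_nonneg_eq_0_iff_AE) (auto intro!: integrable_P0[of _ 1])
  then show ?thesis
    by eventually_elim simp
qed

section \<open>The strong Markov property at hitting times\<close>

definition first_hit :: "int \<Rightarrow> nat \<Rightarrow> (nat \<Rightarrow> int) \<Rightarrow> bool" where
  "first_hit c n \<omega> \<longleftrightarrow> X n \<omega> = c \<and> (\<forall>k<n. X k \<omega> \<noteq> c)"

text \<open>
  Meaningful only on paths that visit \<open>c\<close>, which is almost every path when \<open>c \<ge> 0\<close>. The predicate
  \<open>first_hit c n\<close> is the version that depends only on the path up to time \<open>n\<close>.
\<close>

definition hit_time :: "int \<Rightarrow> (nat \<Rightarrow> int) \<Rightarrow> nat" where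
  "hit_time c \<omega> = (LEAST k. X k \<omega> = c)"

text \<open>
  For \<open>c = 0\<close> the first visit itself counts as the return.
\<close>

definition returns_before :: "int \<Rightarrow> int \<Rightarrow> (nat \<Rightarrow> int) \<Rightarrow> bool" where
  "returns_before p c \<omega> \<longleftrightarrow> (\<exists>n. first_hit c n \<omega> \<and> reaches_before n 0 p \<omega>)"

lemma measurable_first_hit [measurable]: "Measurable.pred path_space (first_hit c n)"
  unfolding first_hit_def by measurable

lemma measurable_hit_time [measurable]: "hit_time c \<in> path_space \<rightarrow>\<^sub>M count_space UNIV"
  unfolding hit_time_def by measurable

lemma measurable_returns_before [measurable]: "Measurable.pred path_space (returns_before p c)"
  unfolding returns_before_def by measurable

lemma hit_time_eqI: "first_hit c n \<omega> \<Longrightarrow> hit_time c \<omega> = n"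
  unfolding first_hit_def hit_time_def by (rule Least_equality) (auto simp: not_less[symmetric])

lemma first_hit_hit_time: "X k \<omega> = c \<Longrightarrow> first_hit c (hit_time c \<omega>) \<omega>"
  unfolding first_hit_def hit_time_def by (auto intro: LeastI dest: not_less_Least)

lemma hit_time_le: "X k \<omega> = c \<Longrightarrow> hit_time c \<omega> \<le> k"
  unfolding hit_time_def by (rule Least_le)

lemma integral_eq_sum_first_hit:
  fixes F :: "(nat \<Rightarrow> int) \<Rightarrow> real"
  assumes F: "F \<in> borel_measurable path_space" "\<And>\<omega>. \<bar>F \<omega>\<bar> \<le> B"
    and hits: "AE \<omega> in P0. \<exists>k. X k \<omega> = c"
  shows "(\<lambda>n. \<integral>\<omega>. F \<omega> * of_bool (first_hit c n \<omega>) \<partial>P0) sums (\<integral>\<omega>. F \<omega> \<partial>P0)"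
proof -
  note [measurable] = F(1)
  have B: "B \<ge> 0" by (rule order_trans[OF abs_ge_zero F(2)])
  have int: "integrable P0 (\<lambda>\<omega>. F \<omega> * of_bool (P \<omega>))" if [measurable]: "Measurable.pred path_space P" for P
    using F(2) B by (intro integrable_P0[of _ B]) (auto simp: abs_mult)
  have "(\<Sum>n<N. \<integral>\<omega>. F \<omega> * of_bool (first_hit c n \<omega>) \<partial>P0)
      = (\<integral>\<omega>. F \<omega> * of_bool (\<exists>n<N. first_hit c n \<omega>) \<partial>P0)" for N
  proof (induction N)
    case (Suc N)
    have "(\<integral>\<omega>. F \<omega> * of_bool (\<exists>n<Suc N. first_hit c n \<omega>) \<partial>P0)
      = (\<integral>\<omega>. F \<omega> * of_bool (\<exists>n<N. first_hit c n \<omega>) + F \<omega> * of_bool (first_hit c N \<omega>) \<partial>P0)"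
      by (intro Bochner_Integration.integral_cong) (auto simp: less_Suc_eq first_hit_def)
    also have "\<dots> = (\<integral>\<omega>. F \<omega> * of_bool (\<exists>n<N. first_hit c n \<omega>) \<partial>P0)
      + (\<integral>\<omega>. F \<omega> * of_bool (first_hit c N \<omega>) \<partial>P0)"
      by (intro Bochner_Integration.integral_add int) measurable
    finally show ?case using Suc by simp
  qed simp
  moreover have "(\<lambda>N. \<integral>\<omega>. F \<omega> * of_bool (\<exists>n<N. first_hit c n \<omega>) \<partial>P0) \<longlonglongrightarrow> (\<integral>\<omega>. F \<omega> \<partial>P0)"
  proof (rule tendsto_integral_P0[of _ _ B])
    show "\<bar>F \<omega> * of_bool (\<exists>n<N. first_hit c n \<omega>)\<bar> \<le> B" for N \<omega>
      using F(2) B by (auto simp: abs_mult)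
    show "AE \<omega> in P0. (\<lambda>N. F \<omega> * of_bool (\<exists>n<N. first_hit c n \<omega>)) \<longlonglongrightarrow> F \<omega>"
      using hits
    proof eventually_elim
      case (elim \<omega>)
      then obtain k where "first_hit c k \<omega>" using first_hit_hit_time by blast
      then have "F \<omega> * of_bool (\<exists>n<N. first_hit c n \<omega>) = F \<omega>" if "N \<ge> Suc k" for N
        using that by (auto simp: Suc_le_eq)
      then show ?case
        by (intro tendsto_eventually eventually_sequentiallyI[of "Suc k"])
    qed
  qed measurable
  ultimately show ?thesis by (simp add: sums_def)
qed

text \<open>
  The strong Markov property at the first visit to \<open>c\<close>, reduced to the ordinary one by summing over
  the possible values \<open>n\<close> of the hitting time: the return event has conditional probability
  \<open>(p - c) / p\<close> whatever happened before that visit. The hypotheses on \<open>Q\<close> say that \<open>G\<close> is determined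
  by the path up to the first visit to \<open>c\<close>.
\<close>

lemma return_probability_at_hit:
  fixes p c :: int and G :: "(nat \<Rightarrow> int) \<Rightarrow> real" and Q :: "nat \<Rightarrow> (nat \<Rightarrow> int) \<Rightarrow> real"
  assumes c: "0 \<le> c" "c \<le> p" "1 \<le> p"
    and Q: "\<And>n. known_at n (Q n)"
    and G: "G \<in> borel_measurable path_space" "\<And>\<omega>. \<bar>G \<omega>\<bar> \<le> B"
    and GQ: "AE \<omega> in P0. \<forall>n. first_hit c n \<omega> \<longrightarrow> G \<omega> = Q n \<omega>"
  shows "real_of_int p * (\<integral>\<omega>. G \<omega> * of_bool (returns_before p c \<omega>) \<partial>P0)
       = real_of_int (p - c) * (\<integral>\<omega>. G \<omega> \<partial>P0)"
proof -
  note [measurable] = G(1) known_at_measurable[OF Q]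
  have B: "B \<ge> 0" by (rule order_trans[OF abs_ge_zero G(2)])
  note hits = AE_hits_nonneg_level[OF c(1)]
  have term_eq: "real_of_int p * (\<integral>\<omega>. G \<omega> * of_bool (returns_before p c \<omega>) * of_bool (first_hit c n \<omega>) \<partial>P0)
      = real_of_int (p - c) * (\<integral>\<omega>. G \<omega> * of_bool (first_hit c n \<omega>) \<partial>P0)" for n
  proof -
    define Z where "Z \<omega> = Q n \<omega> * of_bool (first_hit c n \<omega>)" for \<omega>
    have "known_at n (\<lambda>\<omega>. of_bool (first_hit c n \<omega>))"
      by (rule known_atI[of _ 1]) (auto simp: first_hit_def)
    then have Z: "known_at n Z"
      unfolding Z_def by (intro known_at_mult[OF Q]) auto
    note [measurable] = known_at_measurable[OF Z]
    have "(\<integral>\<omega>. G \<omega> * of_bool (returns_before p c \<omega>) * of_bool (first_hit c n \<omega>) \<partial>P0)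
        = (\<integral>\<omega>. Z \<omega> * of_bool (reaches_before n 0 p \<omega>) \<partial>P0)"
    proof (rule integral_cong_AE)
      show "AE \<omega> in P0. G \<omega> * of_bool (returns_before p c \<omega>) * of_bool (first_hit c n \<omega>)
          = Z \<omega> * of_bool (reaches_before n 0 p \<omega>)"
        using GQ
      proof eventually_elim
        case (elim \<omega>)
        have "returns_before p c \<omega> \<longleftrightarrow> reaches_before n 0 p \<omega>" if "first_hit c n \<omega>"
          using that hit_time_eqI unfolding returns_before_def by blast
        then show ?case using elim by (auto simp: Z_def)
      qed
    qed measurable
    also have "real_of_int p * \<dots> = (\<integral>\<omega>. Z \<omega> * real_of_int (p - X n \<omega>) \<partial>P0)"
      using gamblers_ruin[OF Z, of 0 p] c by (auto simp: Z_def first_hit_def split: if_splits)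
    also have "\<dots> = (\<integral>\<omega>. real_of_int (p - c) * (G \<omega> * of_bool (first_hit c n \<omega>)) \<partial>P0)"
    proof (rule integral_cong_AE)
      show "AE \<omega> in P0. Z \<omega> * real_of_int (p - X n \<omega>) = real_of_int (p - c) * (G \<omega> * of_bool (first_hit c n \<omega>))"
        using GQ by eventually_elim (auto simp: Z_def first_hit_def)
    qed simp_all
    finally show ?thesis by simp
  qed
  have "(\<lambda>n. \<integral>\<omega>. G \<omega> * of_bool (returns_before p c \<omega>) * of_bool (first_hit c n \<omega>) \<partial>P0)
      sums (\<integral>\<omega>. G \<omega> * of_bool (returns_before p c \<omega>) \<partial>P0)"
    using G(2) B by (intro integral_eq_sum_first_hit[where B = B] hits) (auto simp: abs_mult)
  from sums_mult[OF this, of "real_of_int p"]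
  have "(\<lambda>n. real_of_int (p - c) * (\<integral>\<omega>. G \<omega> * of_bool (first_hit c n \<omega>) \<partial>P0))
      sums (real_of_int p * (\<integral>\<omega>. G \<omega> * of_bool (returns_before p c \<omega>) \<partial>P0))"
    by (simp only: term_eq)
  moreover have "(\<lambda>n. real_of_int (p - c) * (\<integral>\<omega>. G \<omega> * of_bool (first_hit c n \<omega>) \<partial>P0))
      sums (real_of_int (p - c) * (\<integral>\<omega>. G \<omega> \<partial>P0))"
    by (intro sums_mult integral_eq_sum_first_hit[OF G hits])
  ultimately show ?thesis by (rule sums_unique2)
qed

lemma walk_path_crosses:
  assumes "walk_path \<omega>" "0 \<le> j" "j \<le> X n \<omega>"
  shows "\<exists>k\<le>n. X k \<omega> = j"
  using assms(3)
proof (induction n)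
  case 0
  then show ?case using assms by (auto simp: walk_path_def)
next
  case (Suc n)
  show ?case
  proof (cases "j \<le> X n \<omega>")
    case True
    with Suc.IH show ?thesis using le_SucI by blast
  next
    case False
    then have "X (Suc n) \<omega> = j"
      using Suc.prems walk_path_step[OF assms(1), of n] by linarith
    then show ?thesis by blast
  qed
qed

section \<open>Bounded martingales at hitting times\<close>

text \<open>
  A version of a bounded martingale for which boundedness and adaptedness hold at every path. The
  martingale property is stated as orthogonality of the increments to the past, the form in which it
  is used for the walk itself.
\<close>

locale bounded_walk_martingale =
  fixes M :: "nat \<Rightarrow> (nat \<Rightarrow> int) \<Rightarrow> real" and C :: real
  assumes known: "known_at n (M n)"
    and bound: "\<bar>M n \<omega>\<bar> \<le> C"
    and orthogonal: "known_at n Z \<Longrightarrow> (\<integral>\<omega>. Z \<omega> * M (Suc n) \<omega> \<partial>P0) = (\<integral>\<omega>. Z \<omega> * M n \<omega> \<partial>P0)"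
begin

lemma measurable_M [measurable]: "M n \<in> borel_measurable path_space"
  by (rule known_at_measurable[OF known])

definition at_hit :: "int \<Rightarrow> (nat \<Rightarrow> int) \<Rightarrow> real" where
  "at_hit c \<omega> = M (hit_time c \<omega>) \<omega>"

definition stopped :: "int \<Rightarrow> nat \<Rightarrow> (nat \<Rightarrow> int) \<Rightarrow> real" where
  "stopped c n \<omega> = (if \<exists>k\<le>n. X k \<omega> = c then at_hit c \<omega> else M n \<omega>)"

lemma measurable_at_hit [measurable]: "at_hit c \<in> borel_measurable path_space"
  unfolding at_hit_def by (rule measurable_compose_countable[OF measurable_M measurable_hit_time])

lemma measurable_stopped [measurable]: "stopped c n \<in> borel_measurable path_space"
  unfolding stopped_def by measurable

lemma at_hit_bound: "\<bar>at_hit c \<omega>\<bar> \<le> C"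
  by (simp add: at_hit_def bound)

lemma stopped_bound: "\<bar>stopped c n \<omega>\<bar> \<le> C"
  by (simp add: stopped_def at_hit_def bound)

text \<open>
  If two paths agree up to time \<open>n\<close> and one of them has visited \<open>c\<close> by then, so has the other, at the
  same time. This is why \<open>stopped\<close> is defined through the condition \<open>\<exists>k\<le>n. X k \<omega> = c\<close>, and not through
  the minimum of \<open>n\<close> and \<open>hit_time\<close>: the latter is arbitrary on paths that never visit \<open>c\<close>.
\<close>

lemma known_stopped: "known_at n (stopped c n)"
proof (rule known_atI[OF measurable_stopped stopped_bound])
  fix \<omega> \<omega>' :: "nat \<Rightarrow> int"
  assume eq: "\<And>k. k \<le> n \<Longrightarrow> X k \<omega> = X k \<omega>'"
  show "stopped c n \<omega> = stopped c n \<omega>'"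
  proof (cases "\<exists>k\<le>n. X k \<omega> = c")
    case True
    then obtain k where k: "k \<le> n" "X k \<omega> = c" by blast
    have le: "hit_time c \<omega> \<le> n" using hit_time_le[OF k(2)] k(1) by simp
    have "first_hit c (hit_time c \<omega>) \<omega>'"
      using first_hit_hit_time[OF k(2)] eq le by (auto simp: first_hit_def)
    then have "hit_time c \<omega>' = hit_time c \<omega>" by (rule hit_time_eqI)
    moreover have "M (hit_time c \<omega>) \<omega> = M (hit_time c \<omega>) \<omega>'"
      using eq le by (intro known_at_cong[OF known]) auto
    ultimately show ?thesis
      using True eq by (auto simp: stopped_def at_hit_def)
  next
    case False
    then show ?thesis
      using eq known_at_cong[OF known, of n \<omega> \<omega>'] by (auto simp: stopped_def)
  qed
qed

lemma integral_stopped: "(\<integral>\<omega>. stopped c n \<omega> \<partial>P0) = (\<integral>\<omega>. M 0 \<omega> \<partial>P0)"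
proof (induction n)
  case 0
  have "stopped c 0 \<omega> = M 0 \<omega>" for \<omega>
    using hit_time_le[of 0 \<omega> c] by (auto simp: stopped_def at_hit_def)
  then show ?case by simp
next
  case (Suc n)
  \<comment> \<open>The stopped process moves from \<open>n\<close> to \<open>n + 1\<close> only if \<open>c\<close> has not been visited by time \<open>n\<close>.\<close>
  let ?Z = "\<lambda>\<omega>. of_bool (\<forall>k\<le>n. X k \<omega> \<noteq> c) :: real"
  have Z: "known_at n ?Z"
    by (rule known_atI[of _ 1]) auto
  have C: "C \<ge> 0" by (rule order_trans[OF abs_ge_zero bound])
  have int: "integrable P0 (\<lambda>\<omega>. ?Z \<omega> * M i \<omega>)" for i
    using bound C by (intro integrable_P0[of _ C]) (auto simp: abs_mult)
  have int': "integrable P0 (stopped c n)"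
    using stopped_bound by (intro integrable_P0[of _ C]) auto
  have "(\<integral>\<omega>. stopped c (Suc n) \<omega> \<partial>P0)
      = (\<integral>\<omega>. stopped c n \<omega> + (?Z \<omega> * M (Suc n) \<omega> - ?Z \<omega> * M n \<omega>) \<partial>P0)"
  proof (intro Bochner_Integration.integral_cong refl)
    fix \<omega>
    have "at_hit c \<omega> = M (Suc n) \<omega>" if "\<forall>k\<le>n. X k \<omega> \<noteq> c" "X (Suc n) \<omega> = c"
      using that hit_time_eqI[of c "Suc n" \<omega>] by (auto simp: first_hit_def at_hit_def less_Suc_eq_le)
    then show "stopped c (Suc n) \<omega> = stopped c n \<omega> + (?Z \<omega> * M (Suc n) \<omega> - ?Z \<omega> * M n \<omega>)"
      by (auto simp: stopped_def le_Suc_eq)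
  qed
  also have "\<dots> = (\<integral>\<omega>. stopped c n \<omega> \<partial>P0)
      + ((\<integral>\<omega>. ?Z \<omega> * M (Suc n) \<omega> \<partial>P0) - (\<integral>\<omega>. ?Z \<omega> * M n \<omega> \<partial>P0))"
    by (subst Bochner_Integration.integral_add[OF int' Bochner_Integration.integrable_diff[OF int int]],
        subst Bochner_Integration.integral_diff[OF int int]) (rule refl)
  finally show ?case
    using Suc orthogonal[OF Z] by simp
qed

lemma integral_at_hit:
  assumes "0 \<le> c"
  shows "(\<integral>\<omega>. at_hit c \<omega> \<partial>P0) = (\<integral>\<omega>. M 0 \<omega> \<partial>P0)"
proof -
  have "(\<lambda>n. \<integral>\<omega>. stopped c n \<omega> \<partial>P0) \<longlonglongrightarrow> (\<integral>\<omega>. at_hit c \<omega> \<partial>P0)"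
  proof (rule tendsto_integral_P0[OF measurable_stopped measurable_at_hit stopped_bound])
    show "AE \<omega> in P0. (\<lambda>n. stopped c n \<omega>) \<longlonglongrightarrow> at_hit c \<omega>"
      using AE_hits_nonneg_level[OF assms]
    proof eventually_elim
      case (elim \<omega>)
      then obtain k where "X k \<omega> = c" by blast
      then have "stopped c n \<omega> = at_hit c \<omega>" if "n \<ge> k" for n
        using that by (auto simp: stopped_def)
      then show ?case
        by (intro tendsto_eventually eventually_sequentiallyI[of k])
    qed
  qed
  then show ?thesis
    by (simp add: integral_stopped LIMSEQ_const_iff)
qed

text \<open>
  On walk paths a first visit to \<open>c \<ge> j\<close> is preceded by a visit to \<open>j\<close>, so the martingale evaluated at
  the first visit to \<open>j\<close> is known by the first visit to \<open>c\<close> and is unaffected by what the walk does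
  afterwards. The formula is needed for \<open>c = j\<close> and for \<open>c = j + 1\<close>.
\<close>

lemma integral_at_hit_returns:
  assumes "0 \<le> j" "j \<le> c" "c \<le> p" "1 \<le> p"
  shows "real_of_int p * (\<integral>\<omega>. at_hit j \<omega> * of_bool (returns_before p c \<omega>) \<partial>P0)
       = real_of_int (p - c) * (\<integral>\<omega>. M 0 \<omega> \<partial>P0)"
proof -
  have "AE \<omega> in P0. \<forall>n. first_hit c n \<omega> \<longrightarrow> at_hit j \<omega> = stopped j n \<omega>"
    using AE_walk_path
  proof eventually_elim
    case (elim \<omega>)
    have "\<exists>k\<le>n. X k \<omega> = j" if "first_hit c n \<omega>" for n
      using that assms by (intro walk_path_crosses[OF elim]) (auto simp: first_hit_def)
    then show ?case by (auto simp: stopped_def)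
  qed
  from return_probability_at_hit[OF _ _ _ known_stopped measurable_at_hit at_hit_bound this]
  show ?thesis
    using assms by (simp add: integral_at_hit)
qed

end

section \<open>Path decomposition at the last zero\<close>

lemma Inf_hits_eq:
  assumes "X k \<omega> = c"
  shows "Inf {enat k | k. X k \<omega> = c} = enat (hit_time c \<omega>)"
proof (rule antisym)
  show "Inf {enat k | k. X k \<omega> = c} \<le> enat (hit_time c \<omega>)"
    using first_hit_hit_time[OF assms] by (intro Inf_lower) (auto simp: first_hit_def)
  show "enat (hit_time c \<omega>) \<le> Inf {enat k | k. X k \<omega> = c}"
    by (intro Inf_greatest) (auto intro: hit_time_le)
qed

text \<open>
  Here \<open>j\<close> is the maximum of the path up to \<open>eta\<close>. It is at least \<open>c\<close> exactly when the path visits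
  \<open>c\<close> by time \<open>eta\<close>; and as \<open>eta\<close> is the last zero before the first visit to \<open>p\<close>, this means that the
  first visit to \<open>c\<close> is followed by a zero that comes before \<open>p\<close>.
\<close>

lemma gamma_path_decomposition:
  assumes \<omega>: "walk_path \<omega>" and hit: "\<exists>k. X k \<omega> = p" and p: "1 \<le> p"
  obtains j where "j \<in> {0..<p}" "gamma p \<omega> = enat (hit_time j \<omega>)"
    "\<And>c. 0 \<le> c \<Longrightarrow> c \<le> p \<Longrightarrow> returns_before p c \<omega> \<longleftrightarrow> c \<le> j"
proof -
  define s where "s = hit_time p \<omega>"
  have s: "X s \<omega> = p" and no_p: "\<And>k. k < s \<Longrightarrow> X k \<omega> \<noteq> p"
    using hit first_hit_hit_time unfolding s_def first_hit_def by blast+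
  have sigma: "sigma_hit p \<omega> = enat s"
    using hit Inf_hits_eq unfolding sigma_hit_def s_def by blast
  define E where "E = {k. k \<le> s \<and> X k \<omega> = 0}"
  have X0: "X 0 \<omega> = 0" using \<omega> by (simp add: walk_path_def)
  have E: "finite E" "0 \<in> E" unfolding E_def using X0 by auto
  \<comment> \<open>The value of \<open>eta\<close> on this path.\<close>
  define e where "e = Max E"
  have eE: "e \<in> E" unfolding e_def using E by (intro Max_in) auto
  have e_max: "k \<le> e" if "k \<in> E" for k unfolding e_def using E that by simp
  have e: "e < s" "X e \<omega> = 0"
    using eE s p unfolding E_def by (auto simp: le_less)
  have eta: "eta p \<omega> = enat e"
    unfolding eta_def sigma
  proof (rule antisym)
    show "Sup {enat k |k. enat k \<le> enat s \<and> X k \<omega> = 0} \<le> enat e"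
      using e_max by (intro Sup_least) (auto simp: E_def)
    show "enat e \<le> Sup {enat k |k. enat k \<le> enat s \<and> X k \<omega> = 0}"
      using e by (intro Sup_upper) auto
  qed
  define m where "m = Max ((\<lambda>k. X k \<omega>) ` {..e})"
  have m_in: "m \<in> (\<lambda>k. X k \<omega>) ` {..e}" unfolding m_def by (intro Max_in) auto
  then obtain k where k: "k \<le> e" "X k \<omega> = m" by auto
  have m_ge: "X i \<omega> \<le> m" if "i \<le> e" for i unfolding m_def using that by (intro Max_ge) auto
  have max: "max_before_eta p \<omega> = m"
  proof -
    have "{X k \<omega> |k. enat k \<le> enat e} = (\<lambda>k. X k \<omega>) ` {..e}" by auto
    then show ?thesis
      unfolding max_before_eta_def eta m_def by (simp add: cSup_eq_Max)
  qed
  have "m < p"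
  proof (rule ccontr)
    assume "\<not> m < p"
    then obtain i where "i \<le> k" "X i \<omega> = p"
      using walk_path_crosses[OF \<omega>, of p k] k p by auto
    then show False using no_p[of i] e k by auto
  qed
  moreover have "0 \<le> m" using m_ge[of 0] X0 by simp
  moreover have "gamma p \<omega> = enat (hit_time m \<omega>)"
    unfolding gamma_def max by (rule Inf_hits_eq[OF k(2)])
  moreover have "returns_before p c \<omega> \<longleftrightarrow> c \<le> m" if c: "0 \<le> c" "c \<le> p" for c
  proof
    assume "returns_before p c \<omega>"
    then obtain n l where n: "first_hit c n \<omega>" and l: "n \<le> l" "X l \<omega> = 0" "\<forall>i\<in>{n..l}. X i \<omega> \<noteq> p"
      unfolding returns_before_def reaches_before_def by blast
    \<comment> \<open>Before its first visit to \<open>c \<le> p\<close> the path cannot have visited \<open>p\<close>.\<close>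
    have "X t \<omega> \<noteq> p" if "t < n" for t
    proof
      assume "X t \<omega> = p"
      then obtain t' where "t' \<le> t" "X t' \<omega> = c"
        using walk_path_crosses[OF \<omega>, of c t] c by auto
      then show False using n that by (auto simp: first_hit_def)
    qed
    then have "\<not> s < n" "s \<notin> {n..l}"
      using l(3) s by auto
    then have "\<not> s \<le> l" by auto
    then have "l \<in> E" using l by (simp add: E_def)
    then have "n \<le> e" using e_max l by fastforce
    then show "c \<le> m" using m_ge[of n] n by (simp add: first_hit_def)
  next
    assume "c \<le> m"
    then obtain i where i: "i \<le> k" "X i \<omega> = c"
      using walk_path_crosses[OF \<omega> c(1), of k] k by auto
    have "hit_time c \<omega> \<le> e"
      using hit_time_le[OF i(2)] i(1) k(1) by simp
    then have "reaches_before (hit_time c \<omega>) 0 p \<omega>"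
      unfolding reaches_before_def using e no_p by (intro exI[of _ e]) auto
    then show "returns_before p c \<omega>"
      unfolding returns_before_def using first_hit_hit_time[OF i(2)] by blast
  qed
  ultimately show ?thesis by (intro that[of m]) auto
qed

text \<open>
  The maximum equals \<open>j\<close> precisely if the walk returns to \<open>0\<close> before \<open>p\<close> from its first visit to \<open>j\<close>
  but not from its first visit to \<open>j + 1\<close>. Given the past of the first visit to \<open>j\<close> this has
  probability \<open>(p - j) / p - (p - j - 1) / p = 1 / p\<close>, so each \<open>j\<close> below \<open>p\<close> contributes one \<open>p\<close>-th
  of the initial expectation.
\<close>

lemma (in bounded_walk_martingale) integral_at_gamma:
  assumes p: "1 \<le> p" and V: "V \<in> borel_measurable path_space"
    and VM: "AE \<omega> in P0. \<forall>n. gamma p \<omega> = enat n \<longrightarrow> V \<omega> = M n \<omega>"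
  shows "(\<integral>\<omega>. V \<omega> \<partial>P0) = (\<integral>\<omega>. M 0 \<omega> \<partial>P0)"
proof -
  note [measurable] = V
  have p0: "0 \<le> p" using p by simp
  let ?A = "\<lambda>c j \<omega>. at_hit j \<omega> * of_bool (returns_before p c \<omega>)"
  have C: "C \<ge> 0" by (rule order_trans[OF abs_ge_zero bound])
  have int: "integrable P0 (?A c j)" for c j
    using at_hit_bound C by (intro integrable_P0[of _ C]) (auto simp: abs_mult)
  have "(\<integral>\<omega>. V \<omega> \<partial>P0) = (\<integral>\<omega>. (\<Sum>j\<in>{0..<p}. ?A j j \<omega> - ?A (j + 1) j \<omega>) \<partial>P0)"
  proof (rule integral_cong_AE)
    show "AE \<omega> in P0. V \<omega> = (\<Sum>j\<in>{0..<p}. ?A j j \<omega> - ?A (j + 1) j \<omega>)"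
      using AE_walk_path AE_hits_nonneg_level[OF p0] VM
    proof eventually_elim
      case (elim \<omega>)
      obtain m where m: "m \<in> {0..<p}" "gamma p \<omega> = enat (hit_time m \<omega>)"
        "\<And>c. 0 \<le> c \<Longrightarrow> c \<le> p \<Longrightarrow> returns_before p c \<omega> \<longleftrightarrow> c \<le> m"
        using gamma_path_decomposition[OF elim(1) elim(2) p] by blast
      have "(\<Sum>j\<in>{0..<p}. ?A j j \<omega> - ?A (j + 1) j \<omega>) = (\<Sum>j\<in>{0..<p}. if j = m then at_hit m \<omega> else 0)"
        by (intro sum.cong refl) (auto simp: m(3))
      also have "\<dots> = at_hit m \<omega>" using m(1) by simp
      also have "\<dots> = V \<omega>" using elim(3) m(2) by (simp add: at_hit_def)
      finally show ?case ..
    qed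
  qed simp_all
  also have "\<dots> = (\<Sum>j\<in>{0..<p}. (\<integral>\<omega>. ?A j j \<omega> \<partial>P0) - (\<integral>\<omega>. ?A (j + 1) j \<omega> \<partial>P0))"
    by (simp add: int Bochner_Integration.integral_sum Bochner_Integration.integral_diff)
  also have "\<dots> = (\<Sum>j\<in>{0..<p}. (\<integral>\<omega>. M 0 \<omega> \<partial>P0) / real_of_int p)"
  proof (intro sum.cong refl)
    fix j assume "j \<in> {0..<p}"
    then have "real_of_int p * ((\<integral>\<omega>. ?A j j \<omega> \<partial>P0) - (\<integral>\<omega>. ?A (j + 1) j \<omega> \<partial>P0)) = (\<integral>\<omega>. M 0 \<omega> \<partial>P0)"
      using integral_at_hit_returns[of j j p] integral_at_hit_returns[of j "j + 1" p] p
      by (simp add: algebra_simps)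
    then show "(\<integral>\<omega>. ?A j j \<omega> \<partial>P0) - (\<integral>\<omega>. ?A (j + 1) j \<omega> \<partial>P0) = (\<integral>\<omega>. M 0 \<omega> \<partial>P0) / real_of_int p"
      using p by (simp add: field_simps)
  qed
  also have "\<dots> = (\<integral>\<omega>. M 0 \<omega> \<partial>P0)"
    using p by simp
  finally show ?thesis .
qed

section \<open>Measurability of the random time\<close>

text \<open>
  The comparisons of \<open>sigma_hit\<close> and \<open>eta\<close> with finite times are countable conditions on the path.
  They hold for every path, including those of measure zero on which the random times are infinite,
  as measurability of \<open>gamma\<close> on the whole space requires.
\<close>

lemma le_sigma_hit_iff: "enat l \<le> sigma_hit p \<omega> \<longleftrightarrow> (\<forall>i<l. X i \<omega> \<noteq> p)"
  unfolding sigma_hit_def le_Inf_iff by (auto simp: not_less[symmetric])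

lemma le_eta_iff: "enat k \<le> eta p \<omega> \<longleftrightarrow> k = 0 \<or> (\<exists>l\<ge>k. enat l \<le> sigma_hit p \<omega> \<and> X l \<omega> = 0)"
proof
  assume le: "enat k \<le> eta p \<omega>"
  show "k = 0 \<or> (\<exists>l\<ge>k. enat l \<le> sigma_hit p \<omega> \<and> X l \<omega> = 0)"
  proof (rule ccontr)
    assume neg: "\<not> ?thesis"
    have "l \<le> k - 1" if "enat l \<le> sigma_hit p \<omega>" "X l \<omega> = 0" for l
    proof -
      have "\<not> k \<le> l" using neg that by blast
      then show ?thesis by simp
    qed
    then have "eta p \<omega> \<le> enat (k - 1)"
      unfolding eta_def by (intro Sup_least) auto
    with le have "enat k \<le> enat (k - 1)" by (rule order_trans)
    moreover have "k \<noteq> 0"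
      by (rule contrapos_nn[OF neg]) (rule disjI1)
    ultimately show False by simp
  qed
next
  assume "k = 0 \<or> (\<exists>l\<ge>k. enat l \<le> sigma_hit p \<omega> \<and> X l \<omega> = 0)"
  then show "enat k \<le> eta p \<omega>"
  proof (elim disjE exE conjE)
    fix l assume "k \<le> l" "enat l \<le> sigma_hit p \<omega>" "X l \<omega> = 0"
    then have "enat l \<le> eta p \<omega>"
      unfolding eta_def by (intro Sup_upper) auto
    with \<open>k \<le> l\<close> show ?thesis by (meson enat_ord_simps(1) order_trans)
  qed (simp add: zero_enat_def[symmetric])
qed

text \<open>
  Unfolding the supremum of integers into a definite description covers the paths that are unbounded
  before \<open>eta\<close> as well: for them the description denotes a fixed, unspecified integer.
\<close>

lemma measurable_max_before_eta [measurable]: "max_before_eta p \<in> path_space \<rightarrow>\<^sub>M count_space UNIV"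
proof -
  have [measurable]: "Measurable.pred path_space (\<lambda>\<omega>. enat k \<le> eta p \<omega>)" for k
    unfolding le_eta_iff le_sigma_hit_iff by measurable
  have "max_before_eta p = (\<lambda>\<omega>. THE v. (\<exists>k. enat k \<le> eta p \<omega> \<and> X k \<omega> = v) \<and>
      (\<forall>k. enat k \<le> eta p \<omega> \<longrightarrow> X k \<omega> \<le> v))"
    unfolding max_before_eta_def Sup_int_def by (intro ext arg_cong[of _ _ The]) auto
  also have "\<dots> \<in> path_space \<rightarrow>\<^sub>M count_space UNIV"
  proof (rule measurable_THE[where I = UNIV])
    show "Measurable.pred path_space (\<lambda>\<omega>. (\<exists>k. enat k \<le> eta p \<omega> \<and> X k \<omega> = v) \<and>
      (\<forall>k. enat k \<le> eta p \<omega> \<longrightarrow> X k \<omega> \<le> v))" for v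
      by measurable
  qed (auto intro: antisym)
  finally show ?thesis .
qed

lemma measurable_gamma: "gamma p \<in> path_space \<rightarrow>\<^sub>M count_space UNIV"
proof -
  have "gamma p = (\<lambda>\<omega>. if \<exists>k. X k \<omega> = max_before_eta p \<omega>
      then enat (LEAST k. X k \<omega> = max_before_eta p \<omega>) else \<infinity>)"
  proof
    fix \<omega>
    show "gamma p \<omega> = (if \<exists>k. X k \<omega> = max_before_eta p \<omega>
      then enat (LEAST k. X k \<omega> = max_before_eta p \<omega>) else \<infinity>)"
      using Inf_hits_eq[of _ \<omega> "max_before_eta p \<omega>"]
      by (auto simp: gamma_def hit_time_def top_enat_def)
  qed
  also have "\<dots> \<in> path_space \<rightarrow>\<^sub>M count_space UNIV"
    by measurable
  finally show ?thesis .
qed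

section \<open>The natural filtration\<close>

text \<open>
  The sets that do not separate two given paths form a \<open>\<sigma>\<close>-algebra, which contains the generators
  of the filtration at time \<open>n\<close> if the paths agree up to that time.
\<close>

lemma natural_filtration_cong:
  assumes f: "f \<in> borel_measurable (natural_filtration n)" and eq: "\<And>k. k \<le> n \<Longrightarrow> X k \<omega> = X k \<omega>'"
  shows "f \<omega> = (f \<omega>' :: real)"
proof -
  have "\<omega> \<in> A \<longleftrightarrow> \<omega>' \<in> A" if "A \<in> sigma_sets UNIV {X k -` A | k A. k \<le> n}" for A
    using that by (induction rule: sigma_sets.induct) (use eq in auto)
  moreover have "f -` {f \<omega>} \<inter> space (natural_filtration n) \<in> sets (natural_filtration n)"
    using f by (rule measurable_sets) simp
  then have "f -` {f \<omega>} \<in> sigma_sets UNIV {X k -` A | k A. k \<le> n}"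
    by (simp add: natural_filtration_def space_measure_of_conv sets_measure_of_conv)
  ultimately have "\<omega> \<in> f -` {f \<omega>} \<longleftrightarrow> \<omega>' \<in> f -` {f \<omega>}"
    by blast
  then show ?thesis by simp
qed

text \<open>
  Composing with the map that stops a path at time \<open>n\<close> does not change \<open>Z\<close>, and this map is
  measurable from the filtration at time \<open>n\<close> to the path space.
\<close>

lemma known_at_natural_filtration:
  assumes Z: "known_at n Z"
  shows "Z \<in> borel_measurable (natural_filtration n)"
proof -
  have "X k \<in> natural_filtration n \<rightarrow>\<^sub>M count_space UNIV" if "k \<le> n" for k
    unfolding natural_filtration_def using that
    by (intro measurableI) (auto simp: space_measure_of_conv sets_measure_of_conv)
  then have "(\<lambda>\<omega> k. X (min k n) \<omega>) \<in> natural_filtration n \<rightarrow>\<^sub>M path_space"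
    unfolding path_space_def by (intro measurable_PiM_single') auto
  from measurable_compose[OF this known_at_measurable[OF Z]]
  have "(\<lambda>\<omega>. Z (\<lambda>k. X (min k n) \<omega>)) \<in> borel_measurable (natural_filtration n)" .
  moreover have "Z (\<lambda>k. X (min k n) \<omega>) = Z \<omega>" for \<omega>
    by (rule known_at_cong[OF Z]) (simp add: X_def)
  ultimately show ?thesis by simp
qed

lemma integral_known_bounded_martingale:
  assumes M: "bounded_martingale P0 natural_filtration M" and Z: "known_at n Z" and le: "n \<le> N"
  shows "(\<integral>\<omega>. Z \<omega> * M N \<omega> \<partial>P0) = (\<integral>\<omega>. Z \<omega> * M n \<omega> \<partial>P0)"
proof -
  interpret finite_measure_subalgebra P0 "natural_filtration n"
    by standard (rule subalgebra_natural_filtration)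
  have [measurable]: "M n \<in> borel_measurable P0" and int: "integrable P0 (M N)" for n
    using M by (auto simp: bounded_martingale_def)
  note [measurable] = known_at_measurable[OF Z]
  obtain B where B: "\<forall>\<omega>. \<bar>Z \<omega>\<bar> \<le> B"
    using known_at_bound[OF Z] by auto
  have "integrable P0 (\<lambda>\<omega>. Z \<omega> * M N \<omega>)"
  proof (rule Bochner_Integration.integrable_bound)
    show "integrable P0 (\<lambda>\<omega>. B * M N \<omega>)" by (simp add: int)
    have "\<bar>Z \<omega>\<bar> \<le> \<bar>B\<bar>" for \<omega>
      using B by (meson abs_ge_self order_trans)
    then show "AE \<omega> in P0. norm (Z \<omega> * M N \<omega>) \<le> norm (B * M N \<omega>)"
      by (intro AE_I2) (simp add: abs_mult mult_right_mono)
  qed measurable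
  from real_cond_exp_intg(2)[OF this known_at_natural_filtration[OF Z] borel_measurable_integrable[OF int]]
  have "(\<integral>\<omega>. Z \<omega> * M N \<omega> \<partial>P0) = (\<integral>\<omega>. Z \<omega> * real_cond_exp P0 (natural_filtration n) (M N) \<omega> \<partial>P0)"
    by simp
  also have "\<dots> = (\<integral>\<omega>. Z \<omega> * M n \<omega> \<partial>P0)"
  proof (rule integral_cong_AE)
    have "AE \<omega> in P0. real_cond_exp P0 (natural_filtration n) (M N) \<omega> = M n \<omega>"
      using M le by (simp add: bounded_martingale_def)
    then show "AE \<omega> in P0. Z \<omega> * real_cond_exp P0 (natural_filtration n) (M N) \<omega> = Z \<omega> * M n \<omega>"
      by eventually_elim simp
  qed measurable
  finally show ?thesis .
qed

text \<open>
  Clipping to the essential bound changes the martingale only on a null set and yields a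
  \<open>bounded_walk_martingale\<close>.
\<close>

lemma integral_value_at_gamma:
  assumes M: "bounded_martingale P0 natural_filtration M" and p: "1 \<le> p"
  shows "(\<integral>\<omega>. value_at M (gamma p) \<omega> \<partial>P0) = (\<integral>\<omega>. M 0 \<omega> \<partial>P0)"
proof -
  have meas_F: "M n \<in> borel_measurable (natural_filtration n)" for n
    using M by (simp add: bounded_martingale_def)
  have meas_P0 [measurable]: "M n \<in> borel_measurable P0" for n
    by (rule measurable_from_subalg[OF subalgebra_natural_filtration meas_F])
  then have [measurable]: "M n \<in> borel_measurable path_space" for n
    by (simp add: measurable_cong_sets[OF sets_P0 refl])
  obtain C where C: "\<And>n. AE \<omega> in P0. \<bar>M n \<omega>\<bar> \<le> C"
    using M by (auto simp: bounded_martingale_def)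
  \<comment> \<open>The essential bound \<open>C\<close> comes without a sign condition; its absolute value makes the clipping interval nonempty.\<close>
  define clip where "clip n \<omega> = max (- \<bar>C\<bar>) (min \<bar>C\<bar> (M n \<omega>))" for n \<omega>
  have clip_eq: "AE \<omega> in P0. clip n \<omega> = M n \<omega>" for n
    using C[of n] by eventually_elim (auto simp: clip_def)
  have [measurable]: "clip n \<in> borel_measurable path_space" for n
    unfolding clip_def by measurable
  have int_eq: "(\<integral>\<omega>. Z \<omega> * clip n \<omega> \<partial>P0) = (\<integral>\<omega>. Z \<omega> * M n \<omega> \<partial>P0)"
    if [measurable]: "Z \<in> borel_measurable path_space" for Z n
  proof (rule integral_cong_AE)
    show "AE \<omega> in P0. Z \<omega> * clip n \<omega> = Z \<omega> * M n \<omega>"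
      using clip_eq[of n] by eventually_elim simp
  qed measurable
  interpret bounded_walk_martingale clip "\<bar>C\<bar>"
  proof
    show clip_le: "\<bar>clip n \<omega>\<bar> \<le> \<bar>C\<bar>" for n \<omega>
      by (auto simp: clip_def)
    show "known_at n (clip n)" for n
    proof (rule known_atI[OF _ clip_le])
      fix \<omega> \<omega>' :: "nat \<Rightarrow> int" assume "\<And>k. k \<le> n \<Longrightarrow> X k \<omega> = X k \<omega>'"
      from natural_filtration_cong[OF meas_F this] show "clip n \<omega> = clip n \<omega>'"
        by (simp add: clip_def)
    qed simp
    show "(\<integral>\<omega>. Z \<omega> * clip (Suc n) \<omega> \<partial>P0) = (\<integral>\<omega>. Z \<omega> * clip n \<omega> \<partial>P0)" if Z: "known_at n Z" for n Z
      using integral_known_bounded_martingale[OF M Z, of "Suc n"] known_at_measurable[OF Z]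
      by (simp add: int_eq)
  qed
  have "value_at M (gamma p) \<in> borel_measurable path_space"
    unfolding value_at_def
  proof (rule measurable_compose_countable[OF _ measurable_gamma])
    show "(\<lambda>\<omega>. case t of enat n \<Rightarrow> M n \<omega> | \<infinity> \<Rightarrow> lim (\<lambda>n. M n \<omega>)) \<in> borel_measurable path_space" for t
      by (cases t) simp_all
  qed
  then have "(\<integral>\<omega>. value_at M (gamma p) \<omega> \<partial>P0) = (\<integral>\<omega>. clip 0 \<omega> \<partial>P0)"
  proof (rule integral_at_gamma[OF p])
    have "AE \<omega> in P0. \<forall>n. clip n \<omega> = M n \<omega>"
      using clip_eq by (simp add: AE_all_countable)
    then show "AE \<omega> in P0. \<forall>n. gamma p \<omega> = enat n \<longrightarrow> value_at M (gamma p) \<omega> = clip n \<omega>"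
      by eventually_elim (simp add: value_at_def)
  qed
  then show ?thesis using int_eq[of "\<lambda>_. 1" 0] by simp
qed

theorem proposition12:
  fixes p :: int
  assumes "p \<ge> 1"
  shows "(\<forall>M. bounded_martingale P0 natural_filtration M \<longrightarrow>
             integral\<^sup>L P0 (value_at M (gamma p)) = integral\<^sup>L P0 (M 0))
         \<and> pseudo_stopping_time P0 natural_filtration (gamma p)"
proof -
  have "random_time P0 (gamma p)"
    unfolding random_time_def measurable_cong_sets[OF sets_P0 refl] by (rule measurable_gamma)
  then show ?thesis
    unfolding pseudo_stopping_time_def using integral_value_at_gamma[OF _ assms] by blast
qed

end
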